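(* Let $\beta=2/\log(e/2)$, let $f=f(n)\to\infty$, let $\epsilon>0$ be a constant, and let $k=k(n)\ge f$ be an integer. Define $\phi=0$ if $k\ge\frac{1+\epsilon}{2}\beta\log n$ and $\phi=n/\exp\!\big(\frac{2(1-\epsilon)}{\beta}k\big)$ if $f\le k<\frac{1+\epsilon}{2}\beta\log n$. Then, as $n\to\infty$, $\Pr(\mathcal G(n,m)\text{ is }k\text{-orientable})\to1$ if $m\le k(n-1)-\phi$, and $\Pr(\mathcal G(n,m)\text{ is }k\text{-orientable})\to0$ if $m\ge kn+1$.
   Context: $\mathcal G(n,m)$ is the uniformly random graph on vertex set $[n]$ with exactly $m$ edges. A graph is $k$-orientable if its edges can be oriented so that every vertex has indegree at most $k$. *)

theory Defs
  imports "HOL-Probability.Probability"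
begin

definition all_edges :: "nat \<Rightarrow> nat set set" where
  "all_edges n = {e. \<exists>u v. u \<in> {1..n} \<and> v \<in> {1..n} \<and> u \<noteq> v \<and> e = {u, v}}"

definition graphs_nm :: "nat \<Rightarrow> nat \<Rightarrow> nat set set set" where
  "graphs_nm n m = {E. E \<subseteq> all_edges n \<and> card E = m}"

definition Gnm :: "nat \<Rightarrow> nat \<Rightarrow> nat set set pmf" where
  "Gnm n m = pmf_of_set (graphs_nm n m)"

text \<open>k-orientable: each edge is oriented towards a head vertex h e in e, so that
  every vertex has indegree (number of edges with head v) at most k.\<close>
definition k_orientable :: "nat \<Rightarrow> nat set set \<Rightarrow> bool" where
  "k_orientable k E = (\<exists>h. (\<forall>e\<in>E. h e \<in> e) \<and> (\<forall>v. card {e\<in>E. h e = v} \<le> k))"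

definition beta_const :: real where
  "beta_const = 2 / ln (exp 1 / 2)"

definition phi :: "real \<Rightarrow> nat \<Rightarrow> nat \<Rightarrow> real" where
  "phi \<epsilon> n k = (if real k \<ge> (1 + \<epsilon>) / 2 * beta_const * ln (real n) then 0
                 else real n / exp (2 * (1 - \<epsilon>) / beta_const * real k))"

end

theory Submission
  imports Defs "HOL-Real_Asymp.Real_Asymp"
begin

text \<open>
  By a capacitated Hall theorem, a graph fails to be \<open>k\<close>-orientable only if some vertex set \<open>S\<close> spans
  more than \<open>k |S|\<close> edges; such sets are excluded by a first moment bound. With \<open>s = |S|\<close>, \<open>t = n - s\<close>
  and \<open>\<sigma> = s / n\<close>, the number of edges inside \<open>S\<close> is hypergeometric with success ratio at most
  \<open>\<sigma>\<^sup>2\<close>, and the Chernoff bound gives probability at most \<open>(\<sigma>\<^sup>s (1 + \<sigma>)\<^sup>t)\<^sup>k\<close>. For \<open>t\<close> much smaller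
  than \<open>n\<close> this is about \<open>exp (- (1 - ln 2) k t)\<close>, where \<open>1 - ln 2 = 2 / \<beta>\<close>, against at most
  \<open>(e n / t)\<^sup>t\<close> choices of \<open>S\<close>. A dense \<open>S\<close> forces \<open>k s < m\<close>, hence \<open>k t > \<phi>\<close>, and this (or, when
  \<open>\<phi> = 0\<close>, the lower bound on \<open>k\<close>) makes \<open>n / t\<close> at most \<open>k exp ((1 - ln 2) k / (1 + \<epsilon>))\<close>, so that the
  sum over \<open>s\<close> is dominated by a geometric series whose ratio tends to \<open>0\<close> with \<open>k \<rightarrow> \<infinity>\<close>.
\<close>

section \<open>Capacitated Hall theorem and the sparsity criterion\<close>

text \<open>
  Rado's argument: if a set \<open>A e\<close> has two elements, one of them can be deleted without violating
  Hall's condition, since two violating families would contradict submodularity of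
  \<open>X \<mapsto> k * card X\<close>.
\<close>
lemma capacitated_hall:
  assumes "finite E" and "\<forall>e\<in>E. finite (A e)"
    and "\<forall>F\<subseteq>E. card F \<le> k * card (\<Union>(A ` F))"
  shows "\<exists>h. (\<forall>e\<in>E. h e \<in> A e) \<and> (\<forall>v. card {e\<in>E. h e = v} \<le> k)"
  using assms(2,3)
proof (induction "\<Sum>e\<in>E. card (A e)" arbitrary: A rule: less_induct)
  case less
  have nonempty: "A e \<noteq> {}" if "e \<in> E" for e
    using less.prems(2)[rule_format, of "{e}"] that by auto
  show ?case
  proof (cases "\<exists>e\<in>E. \<exists>x\<in>A e. \<exists>y\<in>A e. x \<noteq> y")
    case False
    \<comment> \<open>All sets are now singletons, so \<open>h\<close> is forced, and each fibre of
      \<open>h\<close> is a family whose union has at most one point.\<close>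
    define h where "h e = (SOME x. x \<in> A e)" for e
    have h: "h e \<in> A e" if "e \<in> E" for e
      using nonempty[OF that] unfolding h_def by (simp add: some_in_eq)
    have singleton: "A e = {h e}" if "e \<in> E" for e
      using False h[OF that] that by (intro set_eqI) auto
    have "card {e\<in>E. h e = v} \<le> k" for v
    proof -
      let ?F = "{e\<in>E. h e = v}"
      have "card (\<Union>(A ` ?F)) \<le> card {v}"
        by (rule card_mono) (use singleton in auto)
      then have "k * card (\<Union>(A ` ?F)) \<le> k"
        using mult_le_mono2[of "card (\<Union>(A ` ?F))" 1 k] by simp
      moreover have "card ?F \<le> k * card (\<Union>(A ` ?F))"
        by (rule less.prems(2)[rule_format]) auto
      ultimately show ?thesis by linarith
    qed
    then show ?thesis using h by blast
  next
    case True
    then obtain e x y where e: "e \<in> E" and xy: "x \<in> A e" "y \<in> A e" "x \<noteq> y"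
      by blast
    define A' where "A' z = A(e := A e - {z})" for z
    have step: ?thesis if z: "z \<in> A e" and hall: "\<forall>F\<subseteq>E. card F \<le> k * card (\<Union>(A' z ` F))" for z
    proof -
      have fin: "\<forall>d\<in>E. finite (A' z d)"
        using less.prems(1) by (simp add: A'_def)
      have "(\<Sum>d\<in>E. card (A' z d)) < (\<Sum>d\<in>E. card (A d))"
      proof (rule sum_strict_mono_ex1[OF \<open>finite E\<close>])
        show "\<forall>d\<in>E. card (A' z d) \<le> card (A d)"
          by (simp add: A'_def card_Diff1_le)
        show "\<exists>d\<in>E. card (A' z d) < card (A d)"
          using e z less.prems(1) by (intro bexI[of _ e] psubset_card_mono) (auto simp: A'_def)
      qed
      from less.hyps[OF this fin hall] obtain h
        where h: "\<forall>d\<in>E. h d \<in> A' z d" "\<forall>v. card {d\<in>E. h d = v} \<le> k" by blast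
      have "\<forall>d\<in>E. h d \<in> A d"
        using h(1) by (metis A'_def DiffD1 fun_upd_apply)
      with h(2) show ?thesis by blast
    qed
    \<comment> \<open>A family that violates Hall's condition after the deletion must contain
      \<open>e\<close>; dropping \<open>e\<close> from it turns the strict inequality into this
      non-strict one.\<close>
    have violator: "\<exists>F\<subseteq>E. e \<notin> F \<and> k * card (\<Union>(A ` F) \<union> (A e - {z})) \<le> card F"
      if no_hall: "\<not> (\<forall>F\<subseteq>E. card F \<le> k * card (\<Union>(A' z ` F)))" for z
    proof -
      obtain F where F: "F \<subseteq> E" "k * card (\<Union>(A' z ` F)) < card F"
        using no_hall by (auto simp: not_le)
      have fF: "finite F" using F(1) \<open>finite E\<close> by (rule finite_subset)
      have eF: "e \<in> F"
      proof (rule ccontr)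
        assume "e \<notin> F"
        then have "A' z ` F = A ` F" by (auto simp: A'_def)
        with F(2) less.prems(2)[rule_format, OF F(1)] show False by simp
      qed
      have "\<Union>(A' z ` F) = \<Union>(A ` (F - {e})) \<union> (A e - {z})"
        using eF by (auto simp: A'_def split: if_splits)
      moreover have "card F = Suc (card (F - {e}))"
        by (rule card.remove[OF fF eF])
      ultimately show ?thesis
        using F by (intro exI[of _ "F - {e}"]) (simp add: subset_iff)
    qed
    show ?thesis
    proof (rule ccontr)
      assume neg: "\<not> ?thesis"
      obtain F where F: "F \<subseteq> E" "e \<notin> F" "k * card (\<Union>(A ` F) \<union> (A e - {x})) \<le> card F"
        using violator step xy(1) neg by meson
      obtain G where G: "G \<subseteq> E" "e \<notin> G" "k * card (\<Union>(A ` G) \<union> (A e - {y})) \<le> card G"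
        using violator step xy(2) neg by meson
      define U where "U = \<Union>(A ` F) \<union> (A e - {x})"
      define V where "V = \<Union>(A ` G) \<union> (A e - {y})"
      have fin: "finite F" "finite G" "finite U" "finite V"
        using F(1) G(1) \<open>finite E\<close> less.prems(1) e
        by (auto simp: U_def V_def intro: finite_subset intro!: finite_UN_I)
      have "insert e (F \<union> G) \<subseteq> E" "F \<inter> G \<subseteq> E" using F G e by auto
      then have hall: "card (insert e (F \<union> G)) \<le> k * card (\<Union>(A ` insert e (F \<union> G)))"
          "card (F \<inter> G) \<le> k * card (\<Union>(A ` (F \<inter> G)))"
        using less.prems(2)[rule_format] by metis+
      \<comment> \<open>Since \<open>x\<close> and \<open>y\<close> differ, the two truncated copies
        of \<open>A e\<close> together restore \<open>A e\<close>, so Hall's condition applies to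
        the union with \<open>e\<close> added. This extra edge is the surplus of one that yields the
        contradiction.\<close>
      have un: "\<Union>(A ` insert e (F \<union> G)) = U \<union> V"
        using xy by (auto simp: U_def V_def)
      have "card (\<Union>(A ` (F \<inter> G))) \<le> card (U \<inter> V)"
        by (rule card_mono) (use fin in \<open>auto simp: U_def V_def\<close>)
      then have "k * card (\<Union>(A ` (F \<inter> G))) \<le> k * card (U \<inter> V)" by simp
      moreover have "card (insert e (F \<union> G)) = Suc (card (F \<union> G))"
        using F(2) G(2) fin by simp
      ultimately have "Suc (card (F \<union> G) + card (F \<inter> G)) \<le> k * (card (U \<union> V) + card (U \<inter> V))"
        using hall unfolding un distrib_left by linarith
      also have "\<dots> = k * card U + k * card V"
        by (simp only: card_Un_Int[OF fin(3,4), symmetric] distrib_left)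
      also have "\<dots> \<le> card F + card G"
        using F(3) G(3) by (simp add: U_def V_def)
      finally show False
        using card_Un_Int[OF fin(1,2)] by simp
    qed
  qed
qed

text \<open>The edges of a family \<open>F\<close> all lie inside the vertex set
  \<open>\<Union>F\<close>, so sparsity of that set is Hall's condition for edges choosing an
  endpoint.\<close>

lemma k_orientable_if_sparse:
  assumes "E \<subseteq> all_edges n"
    and "\<And>S. S \<subseteq> {1..n} \<Longrightarrow> card {e\<in>E. e \<subseteq> S} \<le> k * card S"
  shows "k_orientable k E"
proof -
  have sub: "E \<subseteq> Pow {1..n}" using assms(1) by (auto simp: all_edges_def)
  then have fin: "finite E" by (rule finite_subset) simp
  have "card F \<le> k * card (\<Union>((\<lambda>e. e) ` F))" if "F \<subseteq> E" for F
  proof -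
    have "card F \<le> card {e\<in>E. e \<subseteq> \<Union>F}"
      by (rule card_mono) (use fin that in auto)
    also have "\<dots> \<le> k * card (\<Union>F)"
      by (rule assms(2)) (use sub that in auto)
    finally show ?thesis by simp
  qed
  moreover have "\<forall>e\<in>E. finite e"
    using sub by (meson PowD finite_atLeastAtMost finite_subset subsetD)
  ultimately show ?thesis
    unfolding k_orientable_def by (intro capacitated_hall[OF fin]) simp_all
qed

section \<open>Edge counts and the pigeonhole bound\<close>

lemma all_edges_altdef: "all_edges n = {e. e \<subseteq> {1..n} \<and> card e = 2}"
  unfolding all_edges_def card_2_iff by (intro Collect_cong) blast

lemma finite_all_edges: "finite (all_edges n)"
  by (simp add: all_edges_altdef)

lemma card_edges_inside:
  assumes "S \<subseteq> {1..n}"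
  shows "card {e\<in>all_edges n. e \<subseteq> S} = card S choose 2"
proof -
  have "{e\<in>all_edges n. e \<subseteq> S} = {e. e \<subseteq> S \<and> card e = 2}"
    using assms by (auto simp: all_edges_altdef)
  then show ?thesis
    using n_subsets[of S 2] assms by (simp add: finite_subset)
qed

lemma card_all_edges: "card (all_edges n) = n choose 2"
  by (simp add: all_edges_altdef n_subsets)

text \<open>Every edge is counted once in the sum of the indegrees, and \<open>n\<close> vertices
  accommodate at most \<open>k * n\<close>.\<close>

lemma not_k_orientable:
  assumes "E \<subseteq> all_edges n" and "k * n < card E"
  shows "\<not> k_orientable k E"
proof
  assume "k_orientable k E"
  then obtain h where h: "\<forall>e\<in>E. h e \<in> e" "\<And>v. card {e\<in>E. h e = v} \<le> k"
    by (auto simp: k_orientable_def)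
  have fin: "finite E" using assms(1) finite_all_edges by (rule finite_subset)
  have "h e \<in> {1..n}" if "e \<in> E" for e
    using that h(1) assms(1) unfolding all_edges_altdef by blast
  then have "E = (\<Union>v\<in>{1..n}. {e\<in>E. h e = v})" by blast
  then have "card E \<le> (\<Sum>v\<in>{1..n}. card {e\<in>E. h e = v})"
    by (metis card_UN_le finite_atLeastAtMost)
  also have "\<dots> \<le> (\<Sum>v\<in>{1..n}. k)" by (rule sum_mono) (rule h(2))
  finally show False using assms(2) by (simp add: mult.commute)
qed

section \<open>Moments of the hypergeometric distribution\<close>

lemma card_supersets:
  assumes "finite A" and "J \<subseteq> A" and "card J \<le> m"
  shows "card {E. J \<subseteq> E \<and> E \<subseteq> A \<and> card E = m} = (card A - card J) choose (m - card J)"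
proof -
  have fJ: "finite J" using assms finite_subset by blast
  have "bij_betw (\<lambda>E. E - J) {E. J \<subseteq> E \<and> E \<subseteq> A \<and> card E = m} {F. F \<subseteq> A - J \<and> card F = m - card J}"
  proof (rule bij_betwI[where g = "\<lambda>F. F \<union> J"])
    show "(\<lambda>E. E - J) \<in> {E. J \<subseteq> E \<and> E \<subseteq> A \<and> card E = m} \<rightarrow> {F. F \<subseteq> A - J \<and> card F = m - card J}"
      using fJ by (auto simp: card_Diff_subset)
    show "(\<lambda>F. F \<union> J) \<in> {F. F \<subseteq> A - J \<and> card F = m - card J} \<rightarrow> {E. J \<subseteq> E \<and> E \<subseteq> A \<and> card E = m}"
    proof
      fix F assume F: "F \<in> {F. F \<subseteq> A - J \<and> card F = m - card J}"
      then have "finite F" "F \<inter> J = {}" using assms(1) finite_subset by blast+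
      then have "card (F \<union> J) = m"
        using F fJ assms(3) by (simp add: card_Un_disjoint)
      then show "F \<union> J \<in> {E. J \<subseteq> E \<and> E \<subseteq> A \<and> card E = m}" using F assms(2) by auto
    qed
  qed auto
  then have "card {E. J \<subseteq> E \<and> E \<subseteq> A \<and> card E = m} = card {F. F \<subseteq> A - J \<and> card F = m - card J}"
    by (rule bij_betw_same_card)
  also have "\<dots> = (card A - card J) choose (m - card J)"
    using assms fJ by (simp add: n_subsets card_Diff_subset)
  finally show ?thesis .
qed

text \<open>Double counting of the pairs \<open>(E, J)\<close> with \<open>J\<close> a
  \<open>j\<close>-subset of \<open>E \<inter> B\<close>. Up to normalisation these are the
  factorial moments of the hypergeometric law.\<close>

lemma sum_choose_inter:
  assumes "finite A" and "B \<subseteq> A" and "j \<le> m"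
  shows "(\<Sum>E | E \<subseteq> A \<and> card E = m. card (E \<inter> B) choose j) =
    (card B choose j) * ((card A - j) choose (m - j))"
proof -
  have fB: "finite B" using assms finite_subset by blast
  have fin: "finite {E. E \<subseteq> A \<and> card E = m}" "finite {J. J \<subseteq> B \<and> card J = j}"
    using assms(1) fB by simp_all
  have "(\<Sum>E | E \<subseteq> A \<and> card E = m. card (E \<inter> B) choose j) =
      (\<Sum>E | E \<subseteq> A \<and> card E = m. \<Sum>J | J \<in> {J. J \<subseteq> B \<and> card J = j} \<and> J \<subseteq> E. 1)"
  proof (rule sum.cong[OF refl])
    fix E assume "E \<in> {E. E \<subseteq> A \<and> card E = m}"
    have "{J. J \<in> {J. J \<subseteq> B \<and> card J = j} \<and> J \<subseteq> E} = {J. J \<subseteq> E \<inter> B \<and> card J = j}" by auto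
    then show "card (E \<inter> B) choose j = (\<Sum>J | J \<in> {J. J \<subseteq> B \<and> card J = j} \<and> J \<subseteq> E. 1)"
      using n_subsets[of "E \<inter> B" j] fB by simp
  qed
  also have "\<dots> = (\<Sum>J | J \<subseteq> B \<and> card J = j. \<Sum>E | E \<in> {E. E \<subseteq> A \<and> card E = m} \<and> J \<subseteq> E. 1)"
    by (rule sum.swap_restrict[OF fin])
  also have "\<dots> = (\<Sum>J | J \<subseteq> B \<and> card J = j. (card A - j) choose (m - j))"
  proof (rule sum.cong[OF refl])
    fix J assume J: "J \<in> {J. J \<subseteq> B \<and> card J = j}"
    have "{E. E \<in> {E. E \<subseteq> A \<and> card E = m} \<and> J \<subseteq> E} = {E. J \<subseteq> E \<and> E \<subseteq> A \<and> card E = m}" by auto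
    then show "(\<Sum>E | E \<in> {E. E \<subseteq> A \<and> card E = m} \<and> J \<subseteq> E. 1) = (card A - j) choose (m - j)"
      using card_supersets[of A J m] J assms by auto
  qed
  also have "\<dots> = (card B choose j) * ((card A - j) choose (m - j))"
    using n_subsets[OF fB, of j] by simp
  finally show ?thesis .
qed

text \<open>In product form, each factor obeys \<open>(M - i) / (N - i) \<le> M / N\<close>.\<close>

lemma binomial_le_ratio_pow:
  assumes "M \<le> N"
  shows "real (M choose j) \<le> real (N choose j) * (real M / real N) ^ j"
proof (cases "j \<le> M")
  case True
  have "real (M choose j) = (\<Prod>i = 0..<j. real (M - i) / real (j - i))"
    using True by (rule binomial_altdef_of_nat)
  also have "\<dots> \<le> (\<Prod>i = 0..<j. (real (N - i) / real (j - i)) * (real M / real N))"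
  proof (rule prod_mono, intro conjI)
    fix i assume i: "i \<in> {0..<j}"
    then have pos: "i < j" "i < M" "0 < N" using True assms by auto
    have "real i * real M \<le> real i * real N" using assms by (simp add: mult_left_mono)
    then have "real (M - i) \<le> real (N - i) * (real M / real N)"
      using pos assms by (simp add: of_nat_diff field_simps)
    then have "real (M - i) / real (j - i) \<le> real (N - i) * (real M / real N) / real (j - i)"
      by (rule divide_right_mono) simp
    then show "real (M - i) / real (j - i) \<le> (real (N - i) / real (j - i)) * (real M / real N)"
      by (simp add: mult.commute)
  qed simp
  also have "\<dots> = (\<Prod>i = 0..<j. real (N - i) / real (j - i)) * (real M / real N) ^ j"
    by (simp only: prod.distrib prod_constant card_atLeastLessThan diff_zero)
  also have "(\<Prod>i = 0..<j. real (N - i) / real (j - i)) = real (N choose j)"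
    using True assms by (intro binomial_altdef_of_nat[symmetric]) simp
  finally show ?thesis .
qed (simp add: binomial_eq_0)

text \<open>Drawing without replacement is dominated by independent draws:
  \<open>(1 + u) ^ x\<close> expands with nonnegative coefficients in the binomials
  \<open>x choose j\<close>, and each factorial moment is at most that of the binomial law with
  success ratio \<open>card B / card A\<close>.\<close>

lemma hypergeometric_mgf:
  fixes u :: real
  assumes "finite A" and "B \<subseteq> A" and "m \<le> card A" and "0 \<le> u"
  shows "(\<Sum>E | E \<subseteq> A \<and> card E = m. (1 + u) ^ card (E \<inter> B)) \<le>
    real (card A choose m) * (1 + u * (real (card B) / real (card A))) ^ m"
proof -
  let ?p = "real (card B) / real (card A)"
  have le: "card B \<le> card A" using assms card_mono by blast
  have expand: "(1 + u) ^ card (E \<inter> B) = (\<Sum>j\<le>m. real (card (E \<inter> B) choose j) * u ^ j)"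
    if "E \<subseteq> A" "card E = m" for E
  proof -
    have "card (E \<inter> B) \<le> m"
      using that assms(1) by (metis card_mono finite_subset inf_le1)
    then have "(\<Sum>j\<le>card (E \<inter> B). real (card (E \<inter> B) choose j) * u ^ j) =
        (\<Sum>j\<le>m. real (card (E \<inter> B) choose j) * u ^ j)"
      by (intro sum.mono_neutral_left) auto
    then show ?thesis
      using binomial_ring[of u 1 "card (E \<inter> B)"] by (simp add: add.commute)
  qed
  have "(\<Sum>E | E \<subseteq> A \<and> card E = m. (1 + u) ^ card (E \<inter> B)) =
      (\<Sum>E | E \<subseteq> A \<and> card E = m. \<Sum>j\<le>m. real (card (E \<inter> B) choose j) * u ^ j)"
    using expand by (intro sum.cong) auto
  also have "\<dots> = (\<Sum>j\<le>m. \<Sum>E | E \<subseteq> A \<and> card E = m. real (card (E \<inter> B) choose j) * u ^ j)"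
    by (rule sum.swap)
  also have "\<dots> = (\<Sum>j\<le>m. real (\<Sum>E | E \<subseteq> A \<and> card E = m. card (E \<inter> B) choose j) * u ^ j)"
    by (simp add: sum_distrib_right)
  also have "\<dots> = (\<Sum>j\<le>m. real (card B choose j) * real ((card A - j) choose (m - j)) * u ^ j)"
    using sum_choose_inter[OF assms(1,2)] by (intro sum.cong) auto
  also have "\<dots> \<le> (\<Sum>j\<le>m. real (card A choose m) * (real (m choose j) * (u * ?p) ^ j))"
  proof (rule sum_mono)
    fix j assume "j \<in> {..m}"
    \<comment> \<open>This identity lets \<open>card A choose m\<close> be pulled out of the sum,
      leaving a binomial expansion.\<close>
    then have "real ((card A choose m) * (m choose j)) = real ((card A choose j) * ((card A - j) choose (m - j)))"
      using choose_mult[of j m "card A"] assms(3) by simp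
    moreover have "real (card B choose j) * real ((card A - j) choose (m - j)) * u ^ j
        \<le> real (card A choose j) * ?p ^ j * real ((card A - j) choose (m - j)) * u ^ j"
      using binomial_le_ratio_pow[OF le, of j] assms(4)
      by (intro mult_right_mono) auto
    moreover have "real (card A choose j) * ?p ^ j * real ((card A - j) choose (m - j)) * u ^ j
        = real ((card A choose j) * ((card A - j) choose (m - j))) * (u * ?p) ^ j"
      by (simp only: power_mult_distrib of_nat_mult mult_ac)
    ultimately show "real (card B choose j) * real ((card A - j) choose (m - j)) * u ^ j
        \<le> real (card A choose m) * (real (m choose j) * (u * ?p) ^ j)"
      by (simp add: mult.assoc [symmetric])
  qed
  also have "\<dots> = real (card A choose m) * (1 + u * ?p) ^ m"
    using binomial_ring[of "u * ?p" 1 m] by (simp add: sum_distrib_left add.commute)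
  finally show ?thesis .
qed

section \<open>Dense vertex sets and the union bound\<close>

text \<open>Markov's inequality for \<open>z ^ card (E \<inter> B)\<close>, where \<open>B\<close>
  holds the possible edges inside \<open>S\<close>. Since \<open>m \<le> k * n\<close>, the exponent
  \<open>m\<close> can be raised to \<open>k * n\<close>, which makes the bound a
  \<open>k\<close>-th power.\<close>

lemma Gnm_dense_subset_prob:
  assumes S: "S \<subseteq> {1..n}" "S \<noteq> {}" and m: "m \<le> n choose 2" "m \<le> k * n"
  defines "\<sigma> \<equiv> real (card S) / real n"
  shows "measure_pmf.prob (Gnm n m) {E. k * card S \<le> card {e\<in>E. e \<subseteq> S}}
    \<le> (\<sigma> ^ card S * (1 + \<sigma>) ^ (n - card S)) ^ k"
proof -
  define s where "s = card S"
  define X where "X = {E. k * s \<le> card {e\<in>E. e \<subseteq> S}}"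
  define B where "B = {e\<in>all_edges n. e \<subseteq> S}"
  define G where "G = graphs_nm n m"
  define D where "D = real ((n choose 2) choose m)"
  have fS: "finite S" using S(1) by (rule finite_subset) simp
  have s: "0 < s" "s \<le> n"
    using S fS card_mono[of "{1..n}" S] by (auto simp: s_def card_gt_0_iff)
  have \<sigma>: "\<sigma> = real s / real n" "0 < \<sigma>" using s by (auto simp: \<sigma>_def s_def)
  have G: "G = {E. E \<subseteq> all_edges n \<and> card E = m}" by (simp add: G_def graphs_nm_def)
  have fG: "finite G" using finite_all_edges by (simp add: G)
  have cardG: "real (card G) = D"
    using n_subsets[OF finite_all_edges, of n m] by (simp add: G D_def card_all_edges)
  have D: "0 < D" using m(1) by (simp add: D_def)
  then have neG: "G \<noteq> {}" using cardG by auto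
  \<comment> \<open>The optimal tilt: it moves the mean ratio \<open>\<sigma>\<^sup>2\<close> to \<open>\<sigma>\<close>.\<close>
  define z where "z = 1 + real n / real s"
  have z: "1 \<le> z" by (simp add: z_def)
  have zs: "z = (1 + \<sigma>) / \<sigma>" using s by (simp add: z_def \<sigma>(1) field_simps)
  have p: "real n / real s * (real (card B) / real (card (all_edges n))) \<le> \<sigma>"
  proof -
    have "real (s choose 2) / real (n choose 2) \<le> \<sigma> ^ 2"
    proof (cases "n choose 2 = 0")
      case False
      then show ?thesis
        using binomial_le_ratio_pow[OF s(2), of 2] by (simp add: \<sigma>(1) field_simps)
    next
      case True
      \<comment> \<open>Division by zero yields 0 here, so the bound is trivial.\<close>
      then show ?thesis by (simp only: True) simp
    qed
    then have "real n / real s * (real (s choose 2) / real (n choose 2)) \<le> real n / real s * \<sigma> ^ 2"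
      by (intro mult_left_mono) simp_all
    also have "\<dots> = \<sigma>" using s by (simp add: \<sigma>(1) power2_eq_square)
    finally show ?thesis
      using S(1) by (simp add: B_def card_edges_inside card_all_edges s_def)
  qed
  have "z ^ (k * s) * real (card (G \<inter> X)) = (\<Sum>E\<in>G \<inter> X. z ^ (k * s))" by simp
  also have "\<dots> \<le> (\<Sum>E\<in>G \<inter> X. z ^ card (E \<inter> B))"
  proof (rule sum_mono)
    fix E assume E: "E \<in> G \<inter> X"
    then have "{e\<in>E. e \<subseteq> S} = E \<inter> B" by (auto simp: G B_def)
    with E show "z ^ (k * s) \<le> z ^ card (E \<inter> B)"
      using z by (intro power_increasing) (auto simp: X_def)
  qed
  also have "\<dots> \<le> (\<Sum>E\<in>G. z ^ card (E \<inter> B))"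
    using fG z by (intro sum_mono2) auto
  also have "\<dots> \<le> D * (1 + real n / real s * (real (card B) / real (card (all_edges n)))) ^ m"
    using hypergeometric_mgf[of "all_edges n" B m "real n / real s"] finite_all_edges m(1)
    by (simp add: G z_def D_def card_all_edges B_def)
  also have "\<dots> \<le> D * (1 + \<sigma>) ^ m"
    using p D by (intro mult_left_mono power_mono) auto
  also have "\<dots> \<le> D * (1 + \<sigma>) ^ (n * k)"
    using \<sigma>(2) m(2) D by (intro mult_left_mono power_increasing) (auto simp: mult.commute)
  finally have main: "z ^ (k * s) * real (card (G \<inter> X)) \<le> D * (1 + \<sigma>) ^ (n * k)" .
  have "(1 + \<sigma>) ^ n = (1 + \<sigma>) ^ s * (1 + \<sigma>) ^ (n - s)"
    using s by (simp flip: power_add)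
  then have "z ^ s * (\<sigma> ^ s * (1 + \<sigma>) ^ (n - s)) = (1 + \<sigma>) ^ n"
    using \<sigma>(2) by (simp add: zs power_divide)
  then have "(1 + \<sigma>) ^ (n * k) = z ^ (k * s) * (\<sigma> ^ s * (1 + \<sigma>) ^ (n - s)) ^ k"
    by (metis power_mult power_mult_distrib mult.commute)
  with main have "z ^ (k * s) * real (card (G \<inter> X)) \<le> z ^ (k * s) * (D * (\<sigma> ^ s * (1 + \<sigma>) ^ (n - s)) ^ k)"
    by (simp add: mult_ac)
  then have "real (card (G \<inter> X)) \<le> D * (\<sigma> ^ s * (1 + \<sigma>) ^ (n - s)) ^ k"
    using z by (subst (asm) mult_le_cancel_left_pos) auto
  moreover have "measure_pmf.prob (Gnm n m) X = real (card (G \<inter> X)) / D"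
    using measure_pmf_of_set[OF neG fG, of X] cardG by (simp add: Gnm_def G_def)
  ultimately show ?thesis
    using D unfolding X_def s_def by (simp add: pos_divide_le_eq mult.commute)
qed

text \<open>Union bound over the dense vertex sets, grouped by size. The restriction
  \<open>k * s < m\<close> is kept because it later bounds \<open>n / (n - s)\<close>.\<close>

lemma prob_not_k_orientable_le:
  assumes m: "m \<le> n choose 2" "m \<le> k * n"
  shows "measure_pmf.prob (Gnm n m) {E. \<not> k_orientable k E} \<le>
    (\<Sum>s | s \<in> {1..<n} \<and> k * s < m.
      real (n choose s) * ((real s / real n) ^ s * (1 + real s / real n) ^ (n - s)) ^ k)"
proof -
  define I where "I = {s. s \<in> {1..<n} \<and> k * s < m}"
  define g where "g s = ((real s / real n) ^ s * (1 + real s / real n) ^ (n - s)) ^ k" for s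
  define \<S> where "\<S> = {S. S \<subseteq> {1..n} \<and> card S \<in> I}"
  define X where "X S = {E. k * card S \<le> card {e\<in>E. e \<subseteq> S}}" for S :: "nat set"
  have fin: "finite \<S>" "finite I" by (auto simp: \<S>_def I_def)
  have ne: "graphs_nm n m \<noteq> {}" "finite (graphs_nm n m)"
  proof -
    have "card (graphs_nm n m) = (n choose 2) choose m"
      using n_subsets[OF finite_all_edges, of n m] by (simp add: graphs_nm_def card_all_edges)
    then show "graphs_nm n m \<noteq> {}" using m(1) by auto
    show "finite (graphs_nm n m)" using finite_all_edges by (simp add: graphs_nm_def)
  qed
  have sub: "{E. \<not> k_orientable k E} \<inter> set_pmf (Gnm n m) \<subseteq> (\<Union>S\<in>\<S>. X S)"
  proof
    fix E assume "E \<in> {E. \<not> k_orientable k E} \<inter> set_pmf (Gnm n m)"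
    then have E: "\<not> k_orientable k E" "E \<subseteq> all_edges n" "card E = m"
      using ne by (auto simp: Gnm_def graphs_nm_def)
    then obtain S where S: "S \<subseteq> {1..n}" "k * card S < card {e\<in>E. e \<subseteq> S}"
      using k_orientable_if_sparse[of E n k] by (meson not_le)
    have fE: "finite E" using E(2) finite_all_edges by (rule finite_subset)
    have "card {e\<in>E. e \<subseteq> S} \<le> m"
      unfolding E(3)[symmetric] by (rule card_mono) (use fE in auto)
    \<comment> \<open>A set spans at most all \<open>m\<close> edges; with
      \<open>m \<le> k * n\<close> this also excludes \<open>card S = n\<close>.\<close>
    then have less: "k * card S < m" using S(2) by linarith
    have "S \<noteq> {}"
    proof
      assume "S = {}"
      then have "{e\<in>E. e \<subseteq> S} = {}" using E(2) by (auto simp: all_edges_altdef)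
      with S(2) show False by simp
    qed
    then have "0 < card S" using S(1) by (meson card_gt_0_iff finite_atLeastAtMost finite_subset)
    moreover have "k * card S < k * n" using less m(2) by linarith
    then have "card S < n" by simp
    ultimately have "S \<in> \<S>" using S(1) less by (simp add: \<S>_def I_def)
    moreover have "E \<in> X S" using S(2) by (simp add: X_def)
    ultimately show "E \<in> (\<Union>S\<in>\<S>. X S)" by blast
  qed
  have "measure_pmf.prob (Gnm n m) {E. \<not> k_orientable k E}
      = measure_pmf.prob (Gnm n m) ({E. \<not> k_orientable k E} \<inter> set_pmf (Gnm n m))"
    by (rule measure_Int_set_pmf[symmetric])
  also have "\<dots> \<le> measure_pmf.prob (Gnm n m) (\<Union>S\<in>\<S>. X S)"
    using sub by (intro measure_pmf.finite_measure_mono) auto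
  also have "\<dots> \<le> (\<Sum>S\<in>\<S>. measure_pmf.prob (Gnm n m) (X S))"
    using fin by (intro measure_pmf.finite_measure_subadditive_finite) auto
  also have "\<dots> \<le> (\<Sum>S\<in>\<S>. g (card S))"
  proof (rule sum_mono)
    fix S assume "S \<in> \<S>"
    then have "S \<subseteq> {1..n}" "S \<noteq> {}" by (auto simp: \<S>_def I_def)
    from Gnm_dense_subset_prob[OF this m]
    show "measure_pmf.prob (Gnm n m) (X S) \<le> g (card S)" by (simp add: X_def g_def)
  qed
  also have "\<dots> = (\<Sum>s\<in>I. \<Sum>S | S \<in> \<S> \<and> card S = s. g (card S))"
    using fin by (intro sum.group[symmetric]) (auto simp: \<S>_def)
  also have "\<dots> = (\<Sum>s\<in>I. real (n choose s) * g s)"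
  proof (rule sum.cong[OF refl])
    fix s assume s: "s \<in> I"
    have "{S. S \<in> \<S> \<and> card S = s} = {S. S \<subseteq> {1..n} \<and> card S = s}"
      using s by (auto simp: \<S>_def)
    then show "(\<Sum>S | S \<in> \<S> \<and> card S = s. g (card S)) = real (n choose s) * g s"
      using n_subsets[of "{1..n}" s] by simp
  qed
  finally show ?thesis by (simp add: I_def g_def)
qed

section \<open>Estimates for the terms of the first moment sum\<close>

text \<open>A single term of the exponential series gives \<open>t ^ t / fact t \<le> exp t\<close>;
  this is combined with \<open>(n choose t) * fact t \<le> n ^ t\<close>.\<close>

lemma binomial_le_exp_pow:
  assumes "0 < t"
  shows "real (n choose t) \<le> (exp 1 * real n / real t) ^ t"
proof (cases "t \<le> n")
  case True
  have "real t ^ t / fact t \<le> exp (real t)"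
  proof -
    have "(\<Sum>i\<in>{t}. inverse (fact i) * real t ^ i) \<le> exp (real t)"
      unfolding exp_def using summable_exp[of "real t"]
      by (intro order.trans[OF sum_le_suminf]) (auto simp: scaleR_conv_of_real)
    then show ?thesis by (simp add: field_simps)
  qed
  then have fact_ge: "real t ^ t \<le> exp (real t) * fact t" by (simp add: field_simps)
  have "real (n choose t) * fact t \<le> real n ^ t"
  proof -
    have "(n choose t) * fact t \<le> n ^ t"
      using binomial_fact_lemma[OF True] fact_div_fact_le_pow[OF True]
      by (metis binomial_fact_pow mult.commute)
    then have "real ((n choose t) * fact t) \<le> real (n ^ t)" by (rule of_nat_mono)
    then show ?thesis by simp
  qed
  then have "real (n choose t) * fact t * real t ^ t \<le> real n ^ t * (exp (real t) * fact t)"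
    using fact_ge by (intro mult_mono) auto
  then have "real (n choose t) * real t ^ t \<le> real n ^ t * exp (real t)"
    by (simp add: mult_ac)
  moreover have "exp (real t) = exp 1 ^ t" by (simp flip: exp_of_nat_mult)
  ultimately show ?thesis
    using assms by (simp add: power_divide power_mult_distrib field_simps)
qed (simp add: binomial_eq_0)

text \<open>Serves to bound the decay rate from below by its value at the left end of a range of
  \<open>\<sigma>\<close>.\<close>

lemma diff_ln_add_one_mono:
  fixes x y :: real
  assumes "0 \<le> x" "x \<le> y"
  shows "x - ln (1 + x) \<le> y - ln (1 + y)"
proof -
  have "ln ((1 + y) / (1 + x)) \<le> (1 + y) / (1 + x) - 1"
    using assms by (intro ln_le_minus_one) auto
  also have "\<dots> = (y - x) / (1 + x)" using assms by (simp add: field_simps)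
  also have "\<dots> \<le> (y - x) / 1" using assms by (intro divide_left_mono) auto
  finally show ?thesis using assms by (simp add: ln_div)
qed

text \<open>From \<open>ln \<sigma> \<le> \<sigma> - 1\<close> and
  \<open>s * (1 - \<sigma>) = t * \<sigma>\<close>. The bound becomes a \<open>t\<close>-th power,
  comparable with the number of choices of the \<open>t\<close>-element complement.\<close>

lemma tilted_prob_le:
  assumes "0 < s" "n = s + t"
  defines "\<sigma> \<equiv> real s / real n"
  shows "\<sigma> ^ s * (1 + \<sigma>) ^ t \<le> exp (- (\<sigma> - ln (1 + \<sigma>))) ^ t"
proof -
  have \<sigma>: "0 < \<sigma>" using assms by simp
  have "real s * ln \<sigma> \<le> real s * (\<sigma> - 1)"
    using \<sigma> by (intro mult_left_mono ln_le_minus_one) auto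
  also have "\<dots> = - (real t * \<sigma>)" using assms by (simp add: \<sigma>_def field_simps)
  finally have "real s * ln \<sigma> + real t * ln (1 + \<sigma>) \<le> real t * (- (\<sigma> - ln (1 + \<sigma>)))"
    by (simp add: algebra_simps)
  then have "exp (real s * ln \<sigma> + real t * ln (1 + \<sigma>)) \<le> exp (real t * (- (\<sigma> - ln (1 + \<sigma>))))"
    by simp
  then show ?thesis
    using \<sigma> by (simp add: exp_add exp_of_nat_mult)
qed

text \<open>The summands of \<open>r\<close> belong to three ranges: \<open>t / n \<le> d\<close>,
  an intermediate range, and \<open>s / n < exp (-2)\<close>. The first two count complements and
  give \<open>r ^ t\<close>; the last counts the sets themselves and gives
  \<open>r ^ s\<close>.\<close>

lemma first_moment_term_le:
  fixes a d c h :: real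
  assumes st: "0 < s" "0 < t" "n = s + t" and k: "1 \<le> k" and d: "0 < d"
    and ratio: "real n / real t \<le> real k * exp (a * real k)"
  defines "h \<equiv> exp (-2) - ln (1 + exp (-2))"
  defines "r \<equiv> exp 1 * real k * exp (- (1 - ln 2 - a - d) * real k)
      + exp 1 / d * exp (- h * real k) + exp (3 - real k)"
  shows "real (n choose s) * ((real s / real n) ^ s * (1 + real s / real n) ^ t) ^ k \<le> r ^ t + r ^ s"
proof -
  define \<sigma> where "\<sigma> = real s / real n"
  define w where "w = \<sigma> - ln (1 + \<sigma>)"
  have n: "0 < n" using st by simp
  have \<sigma>: "0 < \<sigma>" "\<sigma> < 1" "\<sigma> = 1 - real t / real n"
    using st by (auto simp: \<sigma>_def field_simps)
  have r0: "0 \<le> r" using d by (simp add: r_def)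
  have nt: "n choose s = n choose t" using st binomial_symmetric[of s n] by simp
  have ent: "(\<sigma> ^ s * (1 + \<sigma>) ^ t) ^ k \<le> (exp (- w * real k)) ^ t"
  proof -
    have "(\<sigma> ^ s * (1 + \<sigma>) ^ t) ^ k \<le> (exp (- w) ^ t) ^ k"
      using tilted_prob_le[OF st(1,3)] \<sigma> by (intro power_mono) (auto simp: \<sigma>_def w_def)
    also have "\<dots> = (exp (- w * real k)) ^ t"
      by (simp flip: exp_of_nat_mult add: mult_ac)
    finally show ?thesis .
  qed
  have large: ?thesis if "exp 1 * real n / real t * exp (- w * real k) \<le> r"
  proof -
    have "real (n choose s) * (\<sigma> ^ s * (1 + \<sigma>) ^ t) ^ k
        \<le> (exp 1 * real n / real t) ^ t * (exp (- w * real k)) ^ t"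
      unfolding nt using ent binomial_le_exp_pow[OF st(2), of n] \<sigma> by (intro mult_mono) auto
    also have "\<dots> = (exp 1 * real n / real t * exp (- w * real k)) ^ t"
      by (simp only: power_mult_distrib)
    also have "\<dots> \<le> r ^ t" by (intro power_mono that) simp
    also have "\<dots> \<le> r ^ t + r ^ s" using r0 by simp
    finally show ?thesis by (simp add: \<sigma>_def)
  qed
  consider "real t / real n \<le> d" | "d < real t / real n" "exp (-2) \<le> \<sigma>" | "\<sigma> < exp (-2)"
    by linarith
  then show ?thesis
  proof cases
    case 1
    \<comment> \<open>The rate \<open>w\<close> falls short of \<open>1 - ln 2\<close> by at most
      \<open>d\<close>, and the choice of the complement costs a further \<open>a\<close>.\<close>
    have "ln (1 + \<sigma>) \<le> ln 2" using \<sigma> by simp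
    then have "1 - ln 2 - d \<le> w" using 1 \<sigma>(3) by (simp add: w_def)
    then have "exp (- w * real k) \<le> exp (- (1 - ln 2 - d) * real k)"
      by (intro exp_le_cancel_iff[THEN iffD2] mult_right_mono) auto
    then have "exp 1 * (real n / real t) * exp (- w * real k)
        \<le> exp 1 * (real k * exp (a * real k)) * exp (- (1 - ln 2 - d) * real k)"
      using ratio by (intro mult_mono mult_left_mono) auto
    also have "\<dots> = exp 1 * real k * (exp (a * real k) * exp (- (1 - ln 2 - d) * real k))"
      by simp
    also have "exp (a * real k) * exp (- (1 - ln 2 - d) * real k) = exp (- (1 - ln 2 - a - d) * real k)"
      by (simp flip: exp_add add: algebra_simps)
    also have "exp 1 * real k * exp (- (1 - ln 2 - a - d) * real k) \<le> r"
      using d by (simp add: r_def)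
    finally show ?thesis by (intro large) simp
  next
    case 2
    \<comment> \<open>Now \<open>n / t\<close> is below the constant \<open>1 / d\<close>, so a
      fixed positive rate suffices; \<open>h\<close> is the rate at
      \<open>\<sigma> = exp (-2)\<close>.\<close>
    have "h \<le> w" unfolding h_def w_def using 2(2) by (intro diff_ln_add_one_mono) auto
    then have "exp (- w * real k) \<le> exp (- h * real k)" by (simp add: mult_right_mono)
    moreover have "real n / real t \<le> 1 / d" using 2(1) d n st(2) by (simp add: field_simps)
    ultimately have "exp 1 * (real n / real t) * exp (- w * real k) \<le> exp 1 * (1 / d) * exp (- h * real k)"
      using d by (intro mult_mono mult_left_mono) auto
    also have "\<dots> \<le> r" by (simp add: r_def)
    finally show ?thesis by (intro large) simp
  next
    case 3
    have "(1 + \<sigma>) ^ t \<le> exp \<sigma> ^ t" using \<sigma> by (intro power_mono exp_ge_add_one_self) auto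
    also have "\<dots> = exp (real t * \<sigma>)" by (simp add: exp_of_nat_mult)
    also have "\<dots> \<le> exp (real s)"
      using st by (simp add: \<sigma>_def field_simps)
    also have "\<dots> = exp 1 ^ s" by (simp flip: exp_of_nat_mult)
    finally have "\<sigma> ^ s * (1 + \<sigma>) ^ t \<le> (\<sigma> * exp 1) ^ s"
      using \<sigma> by (simp add: power_mult_distrib)
    then have "(\<sigma> ^ s * (1 + \<sigma>) ^ t) ^ k \<le> ((\<sigma> * exp 1) ^ s) ^ k"
      using \<sigma> by (intro power_mono) auto
    moreover have "real (n choose s) \<le> (exp 1 / \<sigma>) ^ s"
      using binomial_le_exp_pow[OF st(1), of n] by (simp add: \<sigma>_def)
    ultimately have "real (n choose s) * (\<sigma> ^ s * (1 + \<sigma>) ^ t) ^ k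
        \<le> (exp 1 / \<sigma>) ^ s * ((\<sigma> * exp 1) ^ s) ^ k"
      using \<sigma> by (intro mult_mono) auto
    also have "\<dots> = (exp 1 / \<sigma> * (\<sigma> * exp 1) ^ k) ^ s"
      by (simp only: power_mult_distrib power_mult[symmetric] mult.commute[of s k])
    also have "\<dots> \<le> r ^ s"
    proof (rule power_mono)
      \<comment> \<open>One of the \<open>k\<close> factors \<open>\<sigma>\<close> cancels the
        \<open>1 / \<sigma>\<close> of the binomial bound. Each of the other \<open>k - 1\<close>
        factors \<open>\<sigma> * exp 1\<close> is below \<open>exp (-1)\<close>, by the cut at
        \<open>exp (-2)\<close>.\<close>
      obtain j where j: "k = Suc j" using k by (cases k) auto
      have "exp 1 / \<sigma> * (\<sigma> * exp 1) ^ k = exp 1 * exp 1 * (\<sigma> * exp 1) ^ j"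
        using \<sigma>(1) by (simp add: j)
      also have "\<dots> \<le> exp 1 * exp 1 * (exp (-2) * exp 1) ^ j"
        using 3 \<sigma> by (intro mult_left_mono power_mono mult_right_mono) auto
      also have "\<dots> = exp (3 - real k)"
        by (simp flip: exp_of_nat_mult exp_add add: j algebra_simps)
      also have "\<dots> \<le> r" using d by (simp add: r_def)
      finally show "exp 1 / \<sigma> * (\<sigma> * exp 1) ^ k \<le> r" .
    qed (use \<sigma>(1) in simp)
    also have "\<dots> \<le> r ^ t + r ^ s" using r0 by simp
    finally show ?thesis by (simp add: \<sigma>_def)
  qed
qed

lemma sum_powers_le:
  fixes r :: real
  assumes "0 \<le> r" "r \<le> 1/2"
  shows "(\<Sum>s\<in>{1..<n}. r ^ (n - s) + r ^ s) \<le> 4 * r"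
proof -
  have geo: "(\<Sum>s\<in>{1..<n}. r ^ s) \<le> 2 * r"
  proof -
    \<comment> \<open>The subtracted \<open>2 * r ^ n\<close> lets the induction close for
      \<open>r \<le> 1/2\<close>.\<close>
    have "(\<Sum>s\<in>{1..<n}. r ^ s) \<le> 2 * r - 2 * r ^ n" if "1 \<le> n" for n
      using that
    proof (induction n rule: dec_induct)
      case (step n)
      have "r * r ^ n \<le> 1/2 * r ^ n" using assms by (intro mult_right_mono) auto
      then show ?case using step by simp
    qed simp
    from this[of n] show ?thesis
      using assms by (cases "n = 0") (auto intro: order.trans)
  qed
  have "(\<Sum>s\<in>{1..<n}. r ^ (n - s)) = (\<Sum>s\<in>{1..<n}. r ^ s)"
    by (rule sum.reindex_bij_witness[of _ "\<lambda>s. n - s" "\<lambda>s. n - s"]) auto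
  then show ?thesis using geo by (simp add: sum.distrib)
qed

section \<open>From the threshold \<open>phi\<close> to the limits\<close>

text \<open>The bounds \<open>k * s < m\<close> and \<open>m \<le> k * (n - 1) - phi\<close> give
  \<open>phi \<le> k * (n - s)\<close>. Where \<open>phi\<close> is nonzero, its definition turns
  this into the claim; where \<open>phi\<close> is 0, the size of \<open>k\<close> already makes
  \<open>n\<close> small enough.\<close>

lemma complement_ratio_le:
  assumes \<epsilon>: "0 < \<epsilon>" and k: "1 \<le> k" and s: "s < n" "k * s < m"
    and m: "real m \<le> real k * (real n - 1) - phi \<epsilon> n k"
  shows "real n / real (n - s) \<le> real k * exp ((1 - ln 2) / (1 + \<epsilon>) * real k)"
proof -
  define c :: real where "c = 1 - ln 2"
  define t where "t = real (n - s)"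
  have c: "0 < c" using ln_less_self[of 2] ln_2_less_1 by (simp add: c_def)
  \<comment> \<open>As \<open>ln (exp 1 / 2) = 1 - ln 2\<close>, the constant
    \<open>beta_const\<close> encodes the decay rate \<open>c\<close>.\<close>
  have beta: "beta_const = 2 / c" by (simp add: beta_const_def c_def ln_div)
  have t: "1 \<le> t" "t = real n - real s" using s by (auto simp: t_def)
  have "real k * real s < real m" using s(2) by (metis of_nat_less_iff of_nat_mult)
  with m have kt: "phi \<epsilon> n k \<le> real k * t"
  proof -
    have "real k * t = real k * (real n - 1) + real k - real k * real s"
      by (simp add: t(2) algebra_simps)
    with \<open>real k * real s < real m\<close> m show ?thesis by linarith
  qed
  have "real n \<le> real k * t * exp (c / (1 + \<epsilon>) * real k)"
  proof (cases "real k \<ge> (1 + \<epsilon>) / 2 * beta_const * ln (real n)")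
    case True
    then have "ln (real n) \<le> c / (1 + \<epsilon>) * real k"
      using c \<epsilon> by (simp add: beta field_simps)
    then have "real n \<le> exp (c / (1 + \<epsilon>) * real k)"
      using s(1) by (metis exp_le_cancel_iff exp_ln gr_implies_not0 neq0_conv of_nat_0_less_iff)
    also have "\<dots> \<le> real k * t * exp (c / (1 + \<epsilon>) * real k)"
      using t(1) k mult_mono[of 1 "real k" 1 t] by simp
    finally show ?thesis .
  next
    case False
    \<comment> \<open>Because \<open>(1 - \<epsilon>) * (1 + \<epsilon>) \<le> 1\<close>, both
      branches share the rate \<open>c / (1 + \<epsilon>)\<close>, which stays below
      \<open>c\<close> however large \<open>\<epsilon>\<close> is.\<close>
    have "(1 - \<epsilon>) * c \<le> c / (1 + \<epsilon>)"
      using c \<epsilon> by (simp add: field_simps)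
    then have le: "exp ((1 - \<epsilon>) * c * real k) \<le> exp (c / (1 + \<epsilon>) * real k)"
      using mult_right_mono by fastforce
    have "real n = phi \<epsilon> n k * exp ((1 - \<epsilon>) * c * real k)"
    proof -
      have "2 * (1 - \<epsilon>) / beta_const = (1 - \<epsilon>) * c" using c by (simp add: beta)
      then show ?thesis using False by (simp add: phi_def)
    qed
    also have "\<dots> \<le> real k * t * exp (c / (1 + \<epsilon>) * real k)"
      using kt le t by (intro mult_mono) auto
    finally show ?thesis .
  qed
  then show ?thesis using t(1) by (simp add: t_def c_def field_simps)
qed

text \<open>For fixed \<open>\<epsilon>\<close> the error involves \<open>k\<close> alone, so the
  limit only needs \<open>k\<close> to diverge. The constant \<open>d\<close> is half the gap
  between the rate \<open>c\<close> and the cost \<open>c / (1 + \<epsilon>)\<close>, hence the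
  first summand of \<open>r\<close> again decays at rate \<open>d\<close>.\<close>

lemma prob_k_orientable_ge:
  fixes \<epsilon> :: real
  defines "c \<equiv> 1 - ln 2"
  defines "d \<equiv> (c - c / (1 + \<epsilon>)) / 2" and "h \<equiv> exp (-2) - ln (1 + exp (-2))"
  defines "r \<equiv> \<lambda>x. exp 1 * x * exp (- d * x) + exp 1 / d * exp (- h * x) + exp (3 - x)"
  assumes \<epsilon>: "0 < \<epsilon>" and k: "1 \<le> k" and n: "1 \<le> n" and m: "m \<le> n choose 2"
    and mk: "real m \<le> real k * (real n - 1) - phi \<epsilon> n k" and r: "r (real k) \<le> 1/2"
  shows "measure_pmf.prob (Gnm n m) {E. k_orientable k E} \<ge> 1 - 4 * r (real k)"
proof -
  have c: "0 < c" using ln_2_less_1 by (simp add: c_def)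
  then have d: "0 < d" using \<epsilon> by (simp add: d_def field_simps)
  have d_eq: "1 - ln 2 - c / (1 + \<epsilon>) - d = d" by (simp add: d_def c_def field_simps)
  have r0: "0 \<le> r (real k)" using d by (simp add: r_def)
  have "0 \<le> phi \<epsilon> n k" by (simp add: phi_def)
  then have "real m \<le> real k * real n" using mk by (simp add: algebra_simps)
  then have mn: "m \<le> k * n" by (metis of_nat_le_iff of_nat_mult)
  have "measure_pmf.prob (Gnm n m) {E. \<not> k_orientable k E} \<le>
      (\<Sum>s | s \<in> {1..<n} \<and> k * s < m.
        real (n choose s) * ((real s / real n) ^ s * (1 + real s / real n) ^ (n - s)) ^ k)"
    by (rule prob_not_k_orientable_le[OF m mn])
  also have "\<dots> \<le> (\<Sum>s | s \<in> {1..<n} \<and> k * s < m. r (real k) ^ (n - s) + r (real k) ^ s)"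
  proof (rule sum_mono)
    fix s assume "s \<in> {s. s \<in> {1..<n} \<and> k * s < m}"
    then have s: "0 < s" "0 < n - s" "n = s + (n - s)" "s < n" "k * s < m" by auto
    from complement_ratio_le[OF \<epsilon> k s(4,5) mk]
    have "real n / real (n - s) \<le> real k * exp (c / (1 + \<epsilon>) * real k)" by (simp add: c_def)
    from first_moment_term_le[OF s(1-3) k d this]
    show "real (n choose s) * ((real s / real n) ^ s * (1 + real s / real n) ^ (n - s)) ^ k
        \<le> r (real k) ^ (n - s) + r (real k) ^ s"
      unfolding d_eq by (simp only: r_def h_def)
  qed
  also have "\<dots> \<le> (\<Sum>s\<in>{1..<n}. r (real k) ^ (n - s) + r (real k) ^ s)"
    using r0 by (intro sum_mono2) auto
  also have "\<dots> \<le> 4 * r (real k)" by (rule sum_powers_le[OF r0 r])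
  finally have "measure_pmf.prob (Gnm n m) (- {E. k_orientable k E}) \<le> 4 * r (real k)"
    by (simp add: Collect_neg_eq)
  then show ?thesis
    using measure_pmf.prob_compl[of "{E. k_orientable k E}" "Gnm n m"] by (simp add: Compl_eq_Diff_UNIV)
qed

lemma prob_k_orientable_eq_0:
  assumes "m \<le> n choose 2" and "k * n < m"
  shows "measure_pmf.prob (Gnm n m) {E. k_orientable k E} = 0"
proof -
  have "card (graphs_nm n m) = (n choose 2) choose m"
    using n_subsets[OF finite_all_edges, of n m] by (simp add: graphs_nm_def card_all_edges)
  then have ne: "graphs_nm n m \<noteq> {}" using assms(1) by auto
  have fin: "finite (graphs_nm n m)" using finite_all_edges by (simp add: graphs_nm_def)
  have "graphs_nm n m \<inter> {E. k_orientable k E} = {}"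
    using not_k_orientable assms(2) by (auto simp: graphs_nm_def)
  then show ?thesis
    by (simp add: Gnm_def measure_pmf_of_set[OF ne fin])
qed

text \<open>The bound \<open>m n \<le> n choose 2\<close> keeps \<open>graphs_nm\<close> nonempty,
  so that \<open>Gnm\<close> is the uniform distribution. The first limit is a squeeze; in the
  second the probability is eventually exactly 0.\<close>

theorem theorem2p7:
  fixes f :: "nat \<Rightarrow> real" and \<epsilon> :: real and k :: "nat \<Rightarrow> nat" and m :: "nat \<Rightarrow> nat"
  assumes "filterlim f at_top sequentially"
    and "\<epsilon> > 0"
    and "eventually (\<lambda>n. real (k n) \<ge> f n) sequentially"
    and "eventually (\<lambda>n. m n \<le> n choose 2) sequentially"
  shows "(eventually (\<lambda>n. real (m n) \<le> real (k n) * (real n - 1) - phi \<epsilon> n (k n)) sequentially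
            \<longrightarrow> ((\<lambda>n. measure_pmf.prob (Gnm n (m n)) {E. k_orientable (k n) E}) \<longlonglongrightarrow> 1))
       \<and> (eventually (\<lambda>n. m n \<ge> k n * n + 1) sequentially
            \<longrightarrow> ((\<lambda>n. measure_pmf.prob (Gnm n (m n)) {E. k_orientable (k n) E}) \<longlonglongrightarrow> 0))"
proof (intro conjI impI)
  assume mk: "eventually (\<lambda>n. real (m n) \<le> real (k n) * (real n - 1) - phi \<epsilon> n (k n)) sequentially"
  \<comment> \<open>The constants of \<open>prob_k_orientable_ge\<close>. Both \<open>d\<close> and
    \<open>h\<close> are positive, so \<open>r\<close> tends to 0 despite the factor
    \<open>x\<close> in its first summand.\<close>
  define d where "d = (1 - ln 2 - (1 - ln 2) / (1 + \<epsilon>)) / (2 :: real)"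
  define h :: real where "h = exp (-2) - ln (1 + exp (-2))"
  define r where "r = (\<lambda>x :: real. exp 1 * x * exp (- d * x) + exp 1 / d * exp (- h * x) + exp (3 - x))"
  have "0 < d" using assms(2) ln_2_less_1 by (simp add: d_def field_simps)
  moreover have "0 < h" unfolding h_def
    using ln_add_one_self_less_self[of "exp (-2) :: real"] by simp
  ultimately have "((\<lambda>x. exp 1 * x * exp (- d * x)) \<longlongrightarrow> 0) at_top"
    "((\<lambda>x. exp 1 / d * exp (- h * x)) \<longlongrightarrow> 0) at_top"
    by real_asymp+
  moreover have "((\<lambda>x :: real. exp (3 - x)) \<longlongrightarrow> 0) at_top" by real_asymp
  ultimately have "(r \<longlongrightarrow> 0) at_top" unfolding r_def
    by (intro tendsto_add_zero)
  moreover have k_top: "filterlim (\<lambda>n. real (k n)) at_top sequentially"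
    using assms(1,3) by (rule filterlim_at_top_mono)
  ultimately have r_lim: "(\<lambda>n. r (real (k n))) \<longlonglongrightarrow> 0" by (rule filterlim_compose)
  have "eventually (\<lambda>n. r (real (k n)) < 1/2) sequentially"
    by (rule order_tendstoD(2)[OF r_lim]) simp
  moreover have "eventually (\<lambda>n. 1 \<le> real (k n)) sequentially"
    using k_top unfolding filterlim_at_top by blast
  ultimately have ge: "eventually (\<lambda>n. 1 - 4 * r (real (k n))
      \<le> measure_pmf.prob (Gnm n (m n)) {E. k_orientable (k n) E}) sequentially"
    using assms(4) mk eventually_ge_at_top[of 1]
  proof eventually_elim
    case (elim n)
    then show ?case
      using prob_k_orientable_ge[OF assms(2), of "k n" n "m n"]
      by (simp add: r_def d_def h_def)
  qed
  show "(\<lambda>n. measure_pmf.prob (Gnm n (m n)) {E. k_orientable (k n) E}) \<longlonglongrightarrow> 1"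
  proof (rule tendsto_sandwich[OF ge])
    show "(\<lambda>n. 1 - 4 * r (real (k n))) \<longlonglongrightarrow> 1"
      using tendsto_diff[OF tendsto_const tendsto_mult[OF tendsto_const r_lim], of 1 4] by simp
  qed auto
next
  assume "eventually (\<lambda>n. m n \<ge> k n * n + 1) sequentially"
  with assms(4) have "eventually (\<lambda>n. measure_pmf.prob (Gnm n (m n)) {E. k_orientable (k n) E} = 0) sequentially"
    by eventually_elim (simp add: prob_k_orientable_eq_0)
  then show "(\<lambda>n. measure_pmf.prob (Gnm n (m n)) {E. k_orientable (k n) E}) \<longlonglongrightarrow> 0"
    by (rule tendsto_eventually)
qed

end
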